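(* Let $n$ be a natural number with $n\geq 52$ and let $\alpha\in(0,1)$. Then $$|A_{2n-1}(\alpha,e^{i\theta})|\leq|A_{2n-1}(\alpha,1)|\quad\text{for all }\theta\in\left[-\frac{\pi}{2},\frac{\pi}{2}\right].$$
   Context: For $\alpha>0$ and $x\in\mathbb{C}$ with $|x|=1$, the numbers $A_m(\alpha,x)$ are the coefficients of the Maclaurin expansion $$\frac{(1+xz)^\alpha}{1-z}=\sum_{m=0}^\infty A_m(\alpha,x)z^m,\qquad |z|<1,$$ where the power is the principal branch. Equivalently, $A_m(\alpha,x)=\sum_{k=0}^{m}\frac{(-\alpha)_k(-x)^k}{k!}$, where $(a)_0=1$ and $(a)_k=a(a+1)\cdots(a+k-1)$ for $k\ge 1$. *)

theory Defs
  imports "HOL-Analysis.Analysis"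
begin

text \<open>
  Maclaurin coefficients in \<open>z\<close> of \<open>(1 + x z)\<^sup>\<alpha> / (1 - z)\<close>.  For complex arguments \<open>powr\<close> is the
  principal branch; it is analytic at the base point because \<open>1 + x z\<close> is close to \<open>1\<close> there.
\<close>
definition A_coeff :: "nat \<Rightarrow> real \<Rightarrow> complex \<Rightarrow> complex" where
  "A_coeff m \<alpha> x =
     (deriv ^^ m) (\<lambda>z. (1 + x * z) powr complex_of_real \<alpha> / (1 - z)) 0 / fact m"

lemma A_coeff_eq_sum:
  "A_coeff m \<alpha> x = (\<Sum>k=0..m. pochhammer (- complex_of_real \<alpha>) k * (- x) ^ k / fact k)"
proof -
  define F where "F = Abs_fps (\<lambda>k. (complex_of_real \<alpha> gchoose k) * x ^ k)"
  have rad: "fps_conv_radius F > 0"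
  proof -
    define r where "r = 1 / (norm x + 1)"
    have r: "r > 0" "norm x * r < 1"
      by (auto simp: r_def add_nonneg_pos divide_simps)
    hence "norm (x * complex_of_real r) < 1"
      by (simp add: norm_mult)
    from gen_binomial_complex[OF this, of "complex_of_real \<alpha>"]
    have "summable (\<lambda>k. fps_nth F k * complex_of_real r ^ k)"
      by (simp add: F_def sums_iff power_mult_distrib mult_ac)
    hence "conv_radius (fps_nth F) \<ge> norm (complex_of_real r)"
      by (rule conv_radius_geI)
    moreover have "0 < ereal (norm (complex_of_real r))"
      using r by simp
    ultimately show ?thesis
      unfolding fps_conv_radius_def by (rule less_le_trans[rotated])
  qed
  have ev: "eventually (\<lambda>z. norm (x * z) < 1) (nhds 0)"
    by (intro order_tendstoD(2)[of _ 0]) (auto intro!: tendsto_eq_intros filterlim_ident)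
  have "(\<lambda>z. (1 + x * z) powr complex_of_real \<alpha>) has_fps_expansion F"
    unfolding has_fps_expansion_def
  proof (intro conjI rad eventually_mono[OF ev])
    fix z assume "norm (x * z) < 1"
    from gen_binomial_complex[OF this, of "complex_of_real \<alpha>"]
    show "eval_fps F z = (1 + x * z) powr complex_of_real \<alpha>"
      by (simp add: eval_fps_def F_def sums_iff power_mult_distrib mult_ac)
  qed
  moreover have "(\<lambda>z::complex. 1 - z) has_fps_expansion (1 - fps_X)"
    by (intro fps_expansion_intros)
  ultimately have "(\<lambda>z. (1 + x * z) powr complex_of_real \<alpha> / (1 - z)) has_fps_expansion
                     (F / (1 - fps_X))"
    by (rule has_fps_expansion_divide') auto
  hence "A_coeff m \<alpha> x = fps_nth (F / (1 - fps_X)) m"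
    unfolding A_coeff_def by (rule fps_nth_fps_expansion[symmetric])
  also have "\<dots> = (\<Sum>k=0..m. fps_nth F k)"
    by (simp add: fps_divide_fps_X_minus1_sum)
  also have "\<dots> = (\<Sum>k=0..m. pochhammer (- complex_of_real \<alpha>) k * (- x) ^ k / fact k)"
  proof (rule sum.cong)
    fix k
    have "(- x) ^ k = (- 1) ^ k * x ^ k"
      by (rule power_minus)
    thus "fps_nth F k = pochhammer (- complex_of_real \<alpha>) k * (- x) ^ k / fact k"
      by (simp add: F_def gbinomial_pochhammer)
  qed auto
  finally show ?thesis .
qed

end

theory Submission
  imports Defs
begin

text \<open>
  Put \<open>y = - x\<close>, \<open>b k = (- 1) ^ (k - 1) * (\<alpha> gchoose k) > 0\<close> and let \<open>m\<close> be odd.  Then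
  \<open>A_coeff m \<alpha> x = (1 + x) powr \<alpha> + T x\<close> with \<open>T x = (\<Sum>k>m. b k * y ^ k)\<close>, and both summands
  are positive at \<open>x = 1\<close>.  With \<open>s = sin\<^sup>2 (\<theta> / 2) = (1 + Re y) / 2\<close>, passing from \<open>x = 1\<close> to
  \<open>x = exp (\<i> * \<theta>)\<close> lowers the modulus of the first summand by at least \<open>2 powr \<alpha> * \<alpha> * s / 2\<close>,
  because \<open>\<bar>1 + x\<bar>\<^sup>2 = 4 * (1 - s)\<close>.  The sequence \<open>b\<close> is completely monotone, so repeated summation
  by parts (Euler's transformation) of \<open>T\<close> has nonnegative coefficients; each step multiplies by
  \<open>1 / \<bar>1 + x\<bar> \<le> 1 / sqrt 2\<close>, and this shows that \<open>\<bar>T x\<bar>\<close> exceeds \<open>T 1\<close> by at most \<open>4 * b (m + 1) * s\<close>.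
  As \<open>b (m + 1) \<le> \<alpha> / (m + 1)\<close>, the gain outweighs the loss.
\<close>

text \<open>
  For \<open>j > 0\<close> this is the \<open>(j - 1)\<close>-st iterated difference, with sign making it positive, of
  \<open>p \<mapsto> (- 1) ^ p * (\<alpha> gchoose Suc p)\<close>; the case \<open>j = 0\<close> extends the scheme one step backwards.
\<close>
definition binom_diff :: "real \<Rightarrow> nat \<Rightarrow> nat \<Rightarrow> real" where
  "binom_diff \<alpha> j p = pochhammer (1 - \<alpha>) p * pochhammer \<alpha> j / fact (p + j)"

text \<open>The tail \<open>T\<close> of the overview is
  \<open>y ^ Suc m * diff_tail \<alpha> 1 m y\<close>; raising \<open>j\<close> gives the series
  that summation by parts produces.\<close>

definition diff_tail :: "real \<Rightarrow> nat \<Rightarrow> nat \<Rightarrow> complex \<Rightarrow> complex" where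
  "diff_tail \<alpha> j p y = (\<Sum>i. of_real (binom_diff \<alpha> j (p + i)) * y ^ i)"

text \<open>After the common factors are taken out, this is (p + j + 1) - (1 - \<alpha> + p) =
  \<alpha> + j.\<close>

lemma binom_diff_rec:
  "binom_diff \<alpha> (Suc j) p = binom_diff \<alpha> j p - binom_diff \<alpha> j (Suc p)"
  by (simp add: binom_diff_def pochhammer_Suc divide_simps) (simp add: algebra_simps)

lemma gbinomial_Suc_eq_binom_diff:
  "\<alpha> gchoose Suc p = (- 1) ^ p * binom_diff \<alpha> 1 p"
  by (simp add: gbinomial_pochhammer binom_diff_def pochhammer_rec)

context
  fixes \<alpha> :: real
  assumes \<alpha>: "0 < \<alpha>" "\<alpha> < 1"
begin

section \<open>Signs, bounds and sums of the iterated differences\<close>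

lemma binom_diff_nonneg: "0 \<le> binom_diff \<alpha> j p"
  using \<alpha> by (simp add: binom_diff_def pochhammer_nonneg)

lemma binom_diff_Suc_le:
  "binom_diff \<alpha> (Suc j) p \<le> binom_diff \<alpha> j p"
  using binom_diff_nonneg[of j "Suc p"] by (simp add: binom_diff_rec)

lemma binom_diff_antimono:
  assumes "i \<le> j"
  shows "binom_diff \<alpha> j p \<le> binom_diff \<alpha> i p"
  using assms by (induction rule: dec_induct) (auto intro: order_trans[OF binom_diff_Suc_le])

lemma binom_diff_1_le: "binom_diff \<alpha> 1 p \<le> \<alpha> / Suc p"
proof -
  have "pochhammer (1 - \<alpha>) p \<le> pochhammer 1 p"
    using \<alpha> by (simp add: pochhammer_prod) (intro prod_mono, auto)
  hence "pochhammer (1 - \<alpha>) p \<le> fact p"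
    by (simp add: pochhammer_fact)
  hence "pochhammer (1 - \<alpha>) p * \<alpha> / fact (Suc p) \<le> fact p * \<alpha> / fact (Suc p)"
    using \<alpha> by (intro divide_right_mono mult_right_mono) auto
  thus ?thesis
    by (simp add: binom_diff_def divide_simps)
qed

lemma binom_diff_Suc_sum_le: "(\<Sum>i<N. binom_diff \<alpha> (Suc j) (p + i)) \<le> binom_diff \<alpha> j p"
proof -
  have "(\<Sum>i<N. binom_diff \<alpha> (Suc j) (p + i)) = binom_diff \<alpha> j p - binom_diff \<alpha> j (p + N)"
    by (induction N) (auto simp: binom_diff_rec)
  thus ?thesis
    using binom_diff_nonneg[of j "p + N"] by simp
qed

text \<open>Level 0 decays only like p to the power -\<alpha> and is not summable, so every series
  here starts at level \<open>Suc j\<close>.\<close>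

lemma summable_binom_diff_Suc: "summable (\<lambda>i. binom_diff \<alpha> (Suc j) (p + i))"
  by (rule summableI_nonneg_bounded[OF binom_diff_nonneg binom_diff_Suc_sum_le])

section \<open>Tails of the series and Euler's transformation\<close>

lemma summable_norm_diff_tail:
  assumes "norm y \<le> 1"
  shows "summable (\<lambda>i. norm (of_real (binom_diff \<alpha> (Suc j) (p + i)) * y ^ i :: complex))"
proof (rule summable_comparison_test'[OF summable_binom_diff_Suc])
  fix i
  show "norm (norm (of_real (binom_diff \<alpha> (Suc j) (p + i)) * y ^ i)) \<le> binom_diff \<alpha> (Suc j) (p + i)"
    using assms binom_diff_nonneg
    by (simp add: norm_mult norm_power mult_left_le power_le_one)
qed

lemma norm_diff_tail_Suc_le:
  assumes "norm y \<le> 1"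
  shows "norm (diff_tail \<alpha> (Suc j) p y) \<le> binom_diff \<alpha> j p"
proof -
  have "norm (diff_tail \<alpha> (Suc j) p y)
      \<le> (\<Sum>i. norm (of_real (binom_diff \<alpha> (Suc j) (p + i)) * y ^ i))"
    unfolding diff_tail_def by (rule summable_norm[OF summable_norm_diff_tail[OF assms]])
  also have "\<dots> \<le> (\<Sum>i. binom_diff \<alpha> (Suc j) (p + i))"
    using assms binom_diff_nonneg
    by (intro suminf_le summable_norm_diff_tail summable_binom_diff_Suc)
      (simp_all add: norm_mult norm_power mult_left_le power_le_one)
  also have "\<dots> \<le> binom_diff \<alpha> j p"
    by (intro suminf_le_const summable_binom_diff_Suc binom_diff_Suc_sum_le)
  finally show ?thesis .
qed

text \<open>One step of Euler's transformation: multiplying by \<open>1 - y\<close> subtracts a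
  shifted copy of the series, and the differences of its coefficients are those of the next
  level.\<close>

lemma diff_tail_by_parts:
  assumes "norm y \<le> 1"
  shows "(1 - y) * diff_tail \<alpha> (Suc j) p y
    = of_real (binom_diff \<alpha> (Suc j) p) - y * diff_tail \<alpha> (Suc (Suc j)) p y"
proof -
  let ?f = "\<lambda>i. of_real (binom_diff \<alpha> (Suc j) (p + i)) * y ^ i"
  have sm: "summable ?f" "summable (\<lambda>i. of_real (binom_diff \<alpha> (Suc (Suc j)) (p + i)) * y ^ i)"
    using assms by (auto intro!: summable_norm_cancel summable_norm_diff_tail)
  have sm': "summable (\<lambda>i. ?f (Suc i))"
    using sm(1) by (subst summable_Suc_iff)
  have "y * diff_tail \<alpha> (Suc (Suc j)) p y
      = (\<Sum>i. y * (of_real (binom_diff \<alpha> (Suc (Suc j)) (p + i)) * y ^ i))"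
    unfolding diff_tail_def using sm(2) by (simp add: suminf_mult)
  also have "\<dots> = (\<Sum>i. y * ?f i - ?f (Suc i))"
    by (simp add: binom_diff_rec[of \<alpha> "Suc j"] algebra_simps)
  also have "\<dots> = (\<Sum>i. y * ?f i) - (\<Sum>i. ?f (Suc i))"
    using sm sm' by (intro suminf_diff[symmetric] summable_mult)
  also have "(\<Sum>i. y * ?f i) = y * suminf ?f"
    using sm by (intro suminf_mult)
  also have "(\<Sum>i. ?f (Suc i)) = suminf ?f - of_real (binom_diff \<alpha> (Suc j) p)"
    using suminf_split_head[OF sm(1)] by simp
  finally show ?thesis
    by (simp add: diff_tail_def algebra_simps)
qed

text \<open>
  The factor \<open>3 / 4\<close> bounds \<open>1 / \<bar>1 - y\<bar> \<le> 1 / sqrt 2\<close>; the term with \<open>(3 / 4) ^ J\<close> is what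
  remains, after \<open>J\<close> summations by parts, of the trivial bound on the tail.
\<close>
lemma norm_diff_tail_excess_aux:
  assumes y: "norm y = 1" "Re y \<le> 0"
  shows "norm (diff_tail \<alpha> (Suc j) p y) - Re (diff_tail \<alpha> (Suc j) p (- 1))
    \<le> 2 * binom_diff \<alpha> 1 p * (1 + Re y) + 2 * binom_diff \<alpha> 0 p * (3 / 4) ^ J"
proof (induction J arbitrary: j)
  case 0
  have "norm (diff_tail \<alpha> (Suc j) p y) \<le> binom_diff \<alpha> j p"
    using y by (intro norm_diff_tail_Suc_le) auto
  moreover have "norm (diff_tail \<alpha> (Suc j) p (- 1)) \<le> binom_diff \<alpha> j p"
    by (intro norm_diff_tail_Suc_le) auto
  moreover have "- Re (diff_tail \<alpha> (Suc j) p (- 1)) \<le> norm (diff_tail \<alpha> (Suc j) p (- 1))"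
    using abs_Re_le_cmod[of "diff_tail \<alpha> (Suc j) p (- 1)"] by linarith
  moreover have "binom_diff \<alpha> j p \<le> binom_diff \<alpha> 0 p"
    by (rule binom_diff_antimono) auto
  moreover have "0 \<le> 2 * binom_diff \<alpha> 1 p * (1 + Re y)"
    using binom_diff_nonneg abs_Re_le_cmod[of y] y by (intro mult_nonneg_nonneg) auto
  ultimately show ?case by (simp only: power_0 mult_1_right)
next
  case (Suc J)
  define d where "d = norm (1 - y)"
  define s where "s = (1 + Re y) / 2"
  define B where "B = binom_diff \<alpha> 1 p"
  define G where "G = binom_diff \<alpha> (Suc j) p"
  define u where "u = norm (diff_tail \<alpha> (Suc (Suc j)) p y)"
  define v where "v = Re (diff_tail \<alpha> (Suc (Suc j)) p (- 1))"
  define r where "r = 2 * B * (1 + Re y) + 2 * binom_diff \<alpha> 0 p * (3 / 4) ^ J"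
  have s: "0 \<le> s" "s \<le> 1 / 2"
    using y abs_Re_le_cmod[of y] by (auto simp: s_def)
  have "Re y ^ 2 + Im y ^ 2 = 1"
    using y by (simp add: cmod_def)
  hence d2: "d ^ 2 = 4 * (1 - s)"
    unfolding d_def cmod_power2 s_def by (simp add: power2_eq_square algebra_simps)
  have d0: "0 \<le> d" by (simp add: d_def)
  \<comment> \<open>As \<open>s \<le> 1 / 2\<close>, \<open>d ^ 2\<close> is at least 2, which
    exceeds 16 / 9.\<close>
  have d_ge: "4 / 3 \<le> d"
    by (rule power2_le_imp_le) (use d2 s d0 in \<open>auto simp: power2_eq_square\<close>)
  \<comment> \<open>Equivalent to \<open>2 \<le> (1 + s) * d\<close>. Squared, this is (1 + s)^2 (1
    - s) \<ge> 1, whose left side expands to 1 + s (1 - s - s^2).\<close>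
  have d_inv: "1 / d - 1 / 2 \<le> s / 2"
  proof -
    have "s ^ 2 \<le> (1 / 2) ^ 2"
      using s by (intro power_mono)
    hence "0 \<le> s * (1 - s - s ^ 2)"
      using s by (intro mult_nonneg_nonneg) (auto simp: power2_eq_square)
    hence "2 ^ 2 \<le> ((1 + s) * d) ^ 2"
      unfolding power_mult_distrib d2 by (simp add: power2_eq_square algebra_simps)
    hence "2 \<le> (1 + s) * d"
      using s d0 by (intro power2_le_imp_le[of 2]) auto
    thus ?thesis using d_ge by (simp add: field_simps)
  qed
  have G: "G \<le> B" "v \<le> B" "0 \<le> G + v" "0 \<le> B" "0 \<le> r"
  proof -
    show "G \<le> B" unfolding G_def B_def by (rule binom_diff_antimono) simp
    have "\<bar>v\<bar> \<le> norm (diff_tail \<alpha> (Suc (Suc j)) p (- 1))"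
      unfolding v_def by (rule abs_Re_le_cmod)
    also have "\<dots> \<le> G"
      unfolding G_def by (intro norm_diff_tail_Suc_le) auto
    finally show "v \<le> B" "0 \<le> G + v" using \<open>G \<le> B\<close> by linarith+
    show "0 \<le> B" unfolding B_def by (rule binom_diff_nonneg)
    have "0 \<le> 1 + Re y" using s by (simp add: s_def)
    thus "0 \<le> r"
      using \<open>0 \<le> B\<close> by (simp add: r_def binom_diff_nonneg)
  qed
  have "d * norm (diff_tail \<alpha> (Suc j) p y)
      = norm (of_real G - y * diff_tail \<alpha> (Suc (Suc j)) p y)"
    using diff_tail_by_parts[of y j p] y by (simp add: d_def G_def flip: norm_mult)
  also have "\<dots> \<le> G + u"
    using norm_triangle_ineq4[of "of_real G" "y * diff_tail \<alpha> (Suc (Suc j)) p y"]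
      binom_diff_nonneg[of "Suc j" p] y
    by (simp add: norm_mult u_def G_def)
  finally have 1: "norm (diff_tail \<alpha> (Suc j) p y) \<le> (G + u) / d"
    using d_ge by (simp add: field_simps)
  have "2 * diff_tail \<alpha> (Suc j) p (- 1)
      = of_real (binom_diff \<alpha> (Suc j) p) + diff_tail \<alpha> (Suc (Suc j)) p (- 1)"
    using diff_tail_by_parts[of "- 1" j p] by simp
  hence "Re (2 * diff_tail \<alpha> (Suc j) p (- 1)) = G + v"
    by (simp add: G_def v_def)
  hence 2: "Re (diff_tail \<alpha> (Suc j) p (- 1)) = (G + v) / 2"
    by simp
  have "u - v \<le> r"
    using Suc[of "Suc j"] by (simp add: u_def v_def r_def B_def)
  hence "(u - v) / d \<le> r / d"
    using d_ge by (intro divide_right_mono) auto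
  also have "\<dots> \<le> r / (4 / 3)"
    using d_ge G by (intro divide_left_mono) auto
  finally have 3: "(u - v) / d \<le> 3 / 4 * r" by simp
  have "(G + v) * (1 / d - 1 / 2) \<le> (G + v) * (s / 2)"
    using d_inv G by (intro mult_left_mono) auto
  also have "\<dots> \<le> (2 * B) * (s / 2)"
    using G s by (intro mult_right_mono) auto
  finally have 4: "(G + v) * (1 / d - 1 / 2) \<le> B * s" by simp
  \<comment> \<open>The first summand is the cost of replacing \<open>1 / d\<close> by 1 / 2, its
    value at \<open>y = - 1\<close>; the second is the excess one level up, contracted by
    \<open>1 / d\<close>.\<close>
  have "(G + u) / d - (G + v) / 2 = (G + v) * (1 / d - 1 / 2) + (u - v) / d"
    using d_ge by (simp add: field_simps)
  hence "norm (diff_tail \<alpha> (Suc j) p y) - Re (diff_tail \<alpha> (Suc j) p (- 1)) \<le> B * s + 3 / 4 * r"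
    using 1 2 3 4 by linarith
  \<comment> \<open>The constant 2 reproduces itself: \<open>B * s\<close> contributes 1 / 2 and the
    contracted bound 3 / 4 * 2.\<close>
  also have "\<dots> = 2 * B * (1 + Re y) + 2 * binom_diff \<alpha> 0 p * (3 / 4) ^ Suc J"
    by (simp add: r_def s_def field_simps)
  finally show ?case by (simp add: B_def)
qed

text \<open>The left side does not depend on \<open>J\<close>, so the geometric remainder disappears
  in the limit.\<close>

lemma norm_diff_tail_excess:
  assumes "norm y = 1" "Re y \<le> 0"
  shows "norm (diff_tail \<alpha> (Suc j) p y) - Re (diff_tail \<alpha> (Suc j) p (- 1))
    \<le> 2 * binom_diff \<alpha> 1 p * (1 + Re y)"
proof (rule tendsto_lowerbound)
  show "(\<lambda>J. 2 * binom_diff \<alpha> 1 p * (1 + Re y) + 2 * binom_diff \<alpha> 0 p * (3 / 4) ^ J)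
      \<longlonglongrightarrow> 2 * binom_diff \<alpha> 1 p * (1 + Re y)"
    by (auto intro!: tendsto_eq_intros LIMSEQ_power_zero)
qed (use norm_diff_tail_excess_aux[OF assms] in auto)

section \<open>The binomial series on the closed unit disc\<close>

lemma gen_binomial_complex_boundary:
  fixes z :: complex
  assumes "norm z \<le> 1" "z \<noteq> - 1"
  shows "(\<lambda>k. of_real (\<alpha> gchoose k) * z ^ k) sums (1 + z) powr of_real \<alpha>"
proof -
  define F where "F = (\<lambda>w::complex. \<Sum>k. of_real (\<alpha> gchoose k) * w ^ k)"
  have "summable (\<lambda>k. norm (\<alpha> gchoose Suc k))"
    using summable_binom_diff_Suc[of 0 0] binom_diff_nonneg
    by (simp add: gbinomial_Suc_eq_binom_diff abs_mult)
  hence sm: "summable (\<lambda>k. norm (\<alpha> gchoose k))"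
    by (subst (asm) summable_Suc_iff)
  have le: "norm (of_real (\<alpha> gchoose k) * w ^ k) \<le> norm (\<alpha> gchoose k)"
    if "norm w \<le> 1" for k and w :: complex
    using that by (simp add: norm_mult norm_power mult_left_le power_le_one)
  \<comment> \<open>Absolutely summable coefficients make the series continuous on the closed disc,
    so the identity known inside it passes to \<open>z\<close> along the radial points
    \<open>r n * z\<close>.\<close>
  have "uniform_limit (cball 0 1) (\<lambda>N w. \<Sum>k<N. of_real (\<alpha> gchoose k) * w ^ k) F sequentially"
    unfolding F_def by (rule Weierstrass_m_test[OF _ sm]) (use le in auto)
  hence contF: "continuous_on (cball 0 1) F"
    by (rule uniform_limit_theorem[rotated])
      (auto intro!: always_eventually continuous_intros)
  define r :: "nat \<Rightarrow> real" where "r = (\<lambda>n. n / Suc n)"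
  have r: "r \<longlonglongrightarrow> 1" "\<And>n. 0 \<le> r n" "\<And>n. r n < 1"
    unfolding r_def using LIMSEQ_n_over_Suc_n by auto
  have lim: "(\<lambda>n. of_real (r n) * z) \<longlonglongrightarrow> z"
    using r(1) by (auto intro!: tendsto_eq_intros)
  have less: "norm (of_real (r n) * z) < 1" for n
    using r(2,3)[of n] assms(1) mult_left_le[of "norm z" "r n"] by (simp add: norm_mult)
  have "(\<lambda>n. F (of_real (r n) * z)) \<longlonglongrightarrow> F z"
    using less assms(1)
    by (intro continuous_on_tendsto_compose[OF contF lim]) (auto intro!: always_eventually less_imp_le)
  moreover have "F (of_real (r n) * z) = (1 + of_real (r n) * z) powr of_real \<alpha>" for n
    using gen_binomial_complex[OF less, of "of_real \<alpha>" n]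
    by (simp add: F_def sums_iff gbinomial_prod_rev)
  moreover have "(\<lambda>n. (1 + of_real (r n) * z) powr of_real \<alpha>) \<longlonglongrightarrow> (1 + z) powr of_real \<alpha>"
  proof (intro tendsto_powr_complex tendsto_intros lim)
    show "1 + z \<notin> \<real>\<^sub>\<le>\<^sub>0"
    proof
      assume "1 + z \<in> \<real>\<^sub>\<le>\<^sub>0"
      hence "Re z \<le> - 1" "Im z = 0" by (auto simp: complex_nonpos_Reals_iff)
      moreover have "- 1 \<le> Re z" using abs_Re_le_cmod[of z] assms(1) by linarith
      ultimately show False using assms(2) by (auto simp: complex_eq_iff)
    qed
  qed
  ultimately have "F z = (1 + z) powr of_real \<alpha>"
    using LIMSEQ_unique by fastforce
  moreover have "summable (\<lambda>k. of_real (\<alpha> gchoose k) * z ^ k)"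
    by (rule summable_norm_cancel, rule summable_comparison_test'[OF sm])
      (use le assms(1) in auto)
  ultimately show ?thesis
    by (simp add: sums_iff F_def)
qed

lemma A_coeff_eq_powr_plus_tail:
  assumes "norm x \<le> 1" "x \<noteq> - 1"
  shows "A_coeff m \<alpha> x = (1 + x) powr of_real \<alpha> + (- x) ^ Suc m * diff_tail \<alpha> 1 m (- x)"
proof -
  let ?f = "\<lambda>k. of_real (\<alpha> gchoose k) * x ^ k"
  have S: "?f sums (1 + x) powr of_real \<alpha>"
    by (rule gen_binomial_complex_boundary[OF assms])
  have A: "A_coeff m \<alpha> x = (\<Sum>k<Suc m. ?f k)"
  proof -
    have "pochhammer (- of_real \<alpha>) k * (- x) ^ k / fact k = ?f k" for k
      by (simp add: gbinomial_pochhammer power_minus[of x] flip: pochhammer_of_real)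
    thus ?thesis
      by (simp add: A_coeff_eq_sum atLeast0AtMost lessThan_Suc_atMost)
  qed
  have eq: "?f (i + Suc m) = - ((- x) ^ Suc m) * (of_real (binom_diff \<alpha> 1 (m + i)) * (- x) ^ i)" for i
    by (simp add: gbinomial_Suc_eq_binom_diff power_add power_minus[of x] mult_ac add.commute[of i])
  have "(1 + x) powr of_real \<alpha> = (\<Sum>i. ?f (i + Suc m)) + (\<Sum>k<Suc m. ?f k)"
    using suminf_split_initial_segment[of ?f "Suc m"] S by (simp add: sums_iff)
  also have "(\<Sum>i. ?f (i + Suc m)) = - ((- x) ^ Suc m) * diff_tail \<alpha> 1 m (- x)"
    unfolding eq diff_tail_def
    using summable_norm_cancel[OF summable_norm_diff_tail[of "- x" 0 m]] assms
    by (intro suminf_mult) simp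
  finally show ?thesis by (simp add: A)
qed

section \<open>Comparison of the two coefficients\<close>

lemma norm_one_plus_powr_le:
  assumes x: "norm x = 1" "0 \<le> Re x"
  shows "norm ((1 + x) powr of_real \<alpha>) \<le> 2 powr \<alpha> * (1 - \<alpha> * (1 - Re x) / 4)"
proof -
  define s where "s = (1 - Re x) / 2"
  have s: "0 \<le> s" "s \<le> 1 / 2"
    using x abs_Re_le_cmod[of x] by (auto simp: s_def)
  have "Re x ^ 2 + Im x ^ 2 = 1"
    using x by (simp add: cmod_def)
  hence "norm (1 + x) ^ 2 = 2 ^ 2 * (1 - s)"
    unfolding cmod_power2 s_def by (simp add: power2_eq_square field_simps)
  hence "norm (1 + x) = sqrt (2 ^ 2 * (1 - s))"
    by (metis norm_ge_zero real_sqrt_unique)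
  hence n: "norm (1 + x) = 2 * (1 - s) powr (1 / 2)"
    using s by (simp only: real_sqrt_mult powr_half_sqrt) simp
  have "norm ((1 + x) powr of_real \<alpha>) = norm (1 + x) powr \<alpha>"
    by (simp add: norm_powr_real_powr')
  also have "\<dots> = 2 powr \<alpha> * ((1 - s) powr (\<alpha> / 2) * 1 powr (1 - \<alpha> / 2))"
    using s by (simp add: n powr_mult powr_powr)
  \<comment> \<open>Bernoulli's bound for \<open>(1 - s) powr (\<alpha> / 2)\<close>, read as
    Young's inequality for \<open>1 - s\<close> and 1; the factor
    \<open>1 powr (1 - \<alpha> / 2)\<close> was inserted for this.\<close>
  also have "\<dots> \<le> 2 powr \<alpha> * (\<alpha> / 2 * (1 - s) + (1 - \<alpha> / 2) * 1)"
    using \<alpha> s by (intro mult_left_mono Youngs_inequality_0) auto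
  finally show ?thesis by (simp add: s_def field_simps)
qed

lemma norm_A_coeff_odd_le:
  assumes m: "odd m" "7 \<le> m" and x: "norm x = 1" "0 \<le> Re x"
  shows "norm (A_coeff m \<alpha> x) \<le> norm (A_coeff m \<alpha> 1)"
proof -
  define B where "B = binom_diff \<alpha> 1 m"
  have "B \<le> \<alpha> / Suc m"
    unfolding B_def by (rule binom_diff_1_le)
  \<comment> \<open>With \<open>8 \<le> Suc m\<close> the loss \<open>2 * B\<close> per unit of
    \<open>1 - Re x\<close> is at most \<alpha> / 4, the gain before its factor
    \<open>2 powr \<alpha> \<ge> 1\<close>.\<close>
  also have "\<dots> \<le> \<alpha> / 8"
    using m \<alpha> by (intro divide_left_mono) auto
  finally have B: "8 * B \<le> \<alpha>" by simp
  have Rx: "0 \<le> 1 - Re x" using x complex_Re_le_cmod[of x] by simp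
  have "8 * B * (1 - Re x) \<le> \<alpha> * (1 - Re x)"
    using B Rx by (intro mult_right_mono) auto
  also have "\<dots> \<le> 2 powr \<alpha> * (\<alpha> * (1 - Re x))"
    using \<alpha> Rx ge_one_powr_ge_zero[of 2 \<alpha>]
      mult_right_mono[of 1 "2 powr \<alpha>" "\<alpha> * (1 - Re x)"] by simp
  finally have gain: "2 * B * (1 - Re x) \<le> 2 powr \<alpha> * (\<alpha> * (1 - Re x) / 4)"
    by simp
  have "A_coeff m \<alpha> x = (1 + x) powr of_real \<alpha> + (- x) ^ Suc m * diff_tail \<alpha> 1 m (- x)"
    using x by (intro A_coeff_eq_powr_plus_tail) auto
  hence "norm (A_coeff m \<alpha> x) \<le> norm ((1 + x) powr of_real \<alpha>) + norm (diff_tail \<alpha> 1 m (- x))"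
    using norm_triangle_ineq[of "(1 + x) powr of_real \<alpha>" "(- x) ^ Suc m * diff_tail \<alpha> 1 m (- x)"] x
    by (simp add: norm_mult norm_power)
  also have "\<dots> \<le> 2 powr \<alpha> * (1 - \<alpha> * (1 - Re x) / 4)
      + (Re (diff_tail \<alpha> 1 m (- 1)) + 2 * B * (1 - Re x))"
    using norm_one_plus_powr_le[OF x] norm_diff_tail_excess[of "- x" 0 m] x
    by (simp add: B_def)
  also have "\<dots> \<le> 2 powr \<alpha> + Re (diff_tail \<alpha> 1 m (- 1))"
    using gain unfolding right_diff_distrib[of "2 powr \<alpha>"] by linarith
  \<comment> \<open>For odd \<open>m\<close> the factor \<open>(- 1) ^ Suc m\<close> is 1, so at
    \<open>x = 1\<close> the tail enters with a plus sign.\<close>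
  also have "\<dots> = Re (A_coeff m \<alpha> 1)"
  proof -
    have "(2::complex) powr of_real \<alpha> = of_real (2 powr \<alpha>)"
      using powr_of_real[of 2 \<alpha>] by simp
    thus ?thesis
      using m A_coeff_eq_powr_plus_tail[of 1 m] by simp
  qed
  also have "\<dots> \<le> norm (A_coeff m \<alpha> 1)"
    by (rule complex_Re_le_cmod)
  finally show ?thesis .
qed

end

theorem theorem1:
  fixes n :: nat and \<alpha> :: real
  assumes "n \<ge> 52" and "\<alpha> \<in> {0<..<1}"
  shows "\<forall>\<theta>::real. \<theta> \<in> {- pi / 2..pi / 2} \<longrightarrow>
           norm (A_coeff (2 * n - 1) \<alpha> (exp (\<i> * complex_of_real \<theta>)))
             \<le> norm (A_coeff (2 * n - 1) \<alpha> 1)"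
proof (intro allI impI)
  fix \<theta> :: real
  assume "\<theta> \<in> {- pi / 2..pi / 2}"
  hence "0 \<le> Re (exp (\<i> * complex_of_real \<theta>))"
    using cos_ge_zero[of \<theta>] by (simp add: Re_exp)
  thus "norm (A_coeff (2 * n - 1) \<alpha> (exp (\<i> * complex_of_real \<theta>)))
      \<le> norm (A_coeff (2 * n - 1) \<alpha> 1)"
    using assms by (intro norm_A_coeff_odd_le) auto
qed

end
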